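(* Let $F$ be a bounded $m\times m$ matrix-valued function on $(0,\infty)$. For every real $s>0$ with $s\notin\mathcal P$, the series defining $(\mathcal R F)(s)$ converges absolutely, and $$G(s)=(\mathcal R(AF))(s)$$ solves the recursion $G=AF+\mathcal K G$, i.e. $$G(s)=A(s)F(s)+A(s)\sum_{i=1}^m E_i\,Q\,G(s/p_i)\qquad (s>0,\ s\notin\mathcal P).$$ Conversely, any solution $G$ of this recursion such that $|G(s)|=O(s^{-1})$ as $s\to\infty$ is given by $G(s)=(\mathcal R(AF))(s)$.
   Context: Let $E=\{1,\dots,m\}$; for each $i\in E$ let $c_i>0$, $\lambda_i>0$, $p_i\in(0,1)$; let $Q=(q_{ij})_{i,j\in E}$ be a stochastic matrix; fix $w>0$. Put $z_i=c_i(\lambda_i+w)$ and $\gamma_i=c_i\lambda_i/p_i$. For a matrix $M$, $|M|=\max_i\sum_j|M_{ij}|$. $E_i$ is the $m\times m$ matrix whose only nonzero entry is a $1$ in position $(i,i)$, and $$A(s)=\mathrm{diag}\Big(\frac{\gamma_1}{z_1-s},\dots,\frac{\gamma_m}{z_m-s}\Big).$$ Phase words: $E^*=\bigcup_{n\ge0}E^n$ is the set of finite words in $E$, including the empty word $\varnothing$. For $\alpha=(i_1,\dots,i_n)$, $|\alpha|=n$, $p_\alpha=\prod_{\ell=1}^n p_{i_\ell}$ (with $p_\varnothing=1$), and $\alpha\upharpoonright_k=(i_1,\dots,i_k)$. Set $\mathcal P=\{z_jp_\alpha: j\in E,\ \alpha\in E^*\}$ (note that $s\notin\mathcal P$ implies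 $s/p_i\notin\mathcal P$). For a nonempty word $\alpha=(i_1,\dots,i_n)$ set $$K_\alpha(s)=A(s)E_{i_1}Q\prod_{k=2}^{n}A\big(s/p_{\alpha\upharpoonright_{k-1}}\big)E_{i_k}Q,$$ the product being ordered from left to right in increasing $k$ (empty product $=I$). For matrix-valued functions $G$ of $s\in(0,\infty)\setminus\mathcal P$ define $$(\mathcal K G)(s)=A(s)\sum_{i\in E}E_iQ\,G(s/p_i),\qquad (\mathcal R G)(s)=G(s)+\sum_{n\ge1}\sum_{|\alpha|=n}K_\alpha(s)\,G(s/p_\alpha),$$ the latter whenever the series converges. The functions $G$ in the statement are defined on $(0,\infty)\setminus\mathcal P$ and the recursion is required at every point of that set. *)

theory Defs
  imports "HOL-Analysis.Analysis" "HOL-Library.Landau_Symbols"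
begin

text \<open>
  The index set \<open>E = {1, ..., m}\<close> is a finite type \<open>'m\<close>; finite words in \<open>E\<close> are lists.
  All functions below are total in \<open>s\<close>; their values at points of \<open>poles\<close> are irrelevant.
\<close>

definition stochastic :: "real^'m^'m \<Rightarrow> bool" where
  "stochastic Q \<longleftrightarrow> (\<forall>i j. 0 \<le> Q $ i $ j) \<and> (\<forall>i. (\<Sum>j\<in>UNIV. Q $ i $ j) = 1)"

definition mat_norm :: "real^'m^'m \<Rightarrow> real" where
  "mat_norm M = Max (range (\<lambda>i. \<Sum>j\<in>UNIV. \<bar>M $ i $ j\<bar>))"

definition zpar :: "('m \<Rightarrow> real) \<Rightarrow> ('m \<Rightarrow> real) \<Rightarrow> real \<Rightarrow> 'm \<Rightarrow> real" where
  "zpar c l w i = c i * (l i + w)"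

definition gpar :: "('m \<Rightarrow> real) \<Rightarrow> ('m \<Rightarrow> real) \<Rightarrow> ('m \<Rightarrow> real) \<Rightarrow> 'm \<Rightarrow> real" where
  "gpar c l p i = c i * l i / p i"

definition unit_mat :: "'m \<Rightarrow> real^'m^'m" where
  "unit_mat i = (\<chi> a b. if a = i \<and> b = i then 1 else 0)"

definition Amat ::
  "('m \<Rightarrow> real) \<Rightarrow> ('m \<Rightarrow> real) \<Rightarrow> ('m \<Rightarrow> real) \<Rightarrow> real \<Rightarrow> real \<Rightarrow> real^'m^'m" where
  "Amat c l p w s = (\<chi> i j. if i = j then gpar c l p i / (zpar c l w i - s) else 0)"

definition word_prob :: "('m \<Rightarrow> real) \<Rightarrow> 'm list \<Rightarrow> real" where
  "word_prob p \<alpha> = prod_list (map p \<alpha>)"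

definition poles :: "('m \<Rightarrow> real) \<Rightarrow> ('m \<Rightarrow> real) \<Rightarrow> ('m \<Rightarrow> real) \<Rightarrow> real \<Rightarrow> real set" where
  "poles c l p w = {zpar c l w j * word_prob p \<alpha> | j \<alpha>. True}"

text \<open>
  Used for nonempty words only. Letters are numbered from 1 in \<open>\<alpha> = (i\<^sub>1, ..., i\<^sub>n)\<close>, so that
  \<open>i\<^sub>k = \<alpha> ! (k - 1)\<close>; the \<open>foldr\<close> is the product over \<open>k = 2, ..., n\<close>, in this order from
  left to right.
\<close>

definition Kword ::
  "('m \<Rightarrow> real) \<Rightarrow> ('m \<Rightarrow> real) \<Rightarrow> ('m \<Rightarrow> real) \<Rightarrow> real \<Rightarrow> real^'m^'m
    \<Rightarrow> 'm list \<Rightarrow> real \<Rightarrow> real^'m^'m" where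
  "Kword c l p w Q \<alpha> s =
     Amat c l p w s ** unit_mat (hd \<alpha>) ** Q **
     foldr (**)
       (map (\<lambda>k. Amat c l p w (s / word_prob p (take (k - 1) \<alpha>)) ** unit_mat (\<alpha> ! (k - 1)) ** Q)
         [2..<length \<alpha> + 1])
       (mat 1)"

definition Kop ::
  "('m \<Rightarrow> real) \<Rightarrow> ('m \<Rightarrow> real) \<Rightarrow> ('m \<Rightarrow> real) \<Rightarrow> real \<Rightarrow> real^'m^'m
    \<Rightarrow> (real \<Rightarrow> real^'m^'m) \<Rightarrow> real \<Rightarrow> real^'m^'m" where
  "Kop c l p w Q G s = Amat c l p w s ** (\<Sum>i\<in>UNIV. unit_mat i ** Q ** G (s / p i))"

text \<open>The series over \<open>n \<ge> 1\<close> is indexed by \<open>n + 1\<close> with \<open>n \<ge> 0\<close>.\<close>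

definition Rop ::
  "('m \<Rightarrow> real) \<Rightarrow> ('m \<Rightarrow> real) \<Rightarrow> ('m \<Rightarrow> real) \<Rightarrow> real \<Rightarrow> real^'m^'m
    \<Rightarrow> (real \<Rightarrow> real^'m^'m) \<Rightarrow> real \<Rightarrow> real^'m^'m" where
  "Rop c l p w Q G s =
     G s + (\<Sum>n. \<Sum>\<alpha> | length \<alpha> = Suc n. Kword c l p w Q \<alpha> s ** G (s / word_prob p \<alpha>))"

text \<open>Absolute convergence is that of the series over all nonempty words, grouped by length.\<close>

definition Rop_abs_convergent ::
  "('m \<Rightarrow> real) \<Rightarrow> ('m \<Rightarrow> real) \<Rightarrow> ('m \<Rightarrow> real) \<Rightarrow> real \<Rightarrow> real^'m^'m
    \<Rightarrow> (real \<Rightarrow> real^'m^'m) \<Rightarrow> real \<Rightarrow> bool" where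
  "Rop_abs_convergent c l p w Q G s \<longleftrightarrow>
     summable (\<lambda>n. \<Sum>\<alpha> | length \<alpha> = Suc n.
       mat_norm (Kword c l p w Q \<alpha> s ** G (s / word_prob p \<alpha>)))"

definition solves_recursion ::
  "('m \<Rightarrow> real) \<Rightarrow> ('m \<Rightarrow> real) \<Rightarrow> ('m \<Rightarrow> real) \<Rightarrow> real \<Rightarrow> real^'m^'m
    \<Rightarrow> (real \<Rightarrow> real^'m^'m) \<Rightarrow> (real \<Rightarrow> real^'m^'m) \<Rightarrow> bool" where
  "solves_recursion c l p w Q F G \<longleftrightarrow>
     (\<forall>s>0. s \<notin> poles c l p w \<longrightarrow> G s = Amat c l p w s ** F s + Kop c l p w Q G s)"

end

theory Submission
  imports Defs "HOL-Real_Asymp.Real_Asymp"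
begin

text \<open>
  Let \<open>T\<^sub>n H (s)\<close> be the sum of \<open>K\<^sub>\<alpha>(s) H(s / p\<^sub>\<alpha>)\<close> over the words \<open>\<alpha>\<close> of length \<open>n\<close>.
  Splitting off the first letter of a word gives \<open>T\<^sub>n\<^sub>+\<^sub>1 H = \<K> (T\<^sub>n H)\<close>, so that \<open>\<R> H\<close> is the
  Neumann series of \<open>\<K>\<close> and, wherever it converges, \<open>\<R> H = H + \<K> (\<R> H)\<close>.

  Convergence: \<open>K\<^sub>\<alpha>(s)\<close> with \<open>|\<alpha>| = n\<close> has norm at most \<open>a\<^sub>0 \<cdots> a\<^sub>n\<^sub>-\<^sub>1\<close>, where \<open>a\<^sub>k\<close> is the largest
  \<open>|A(s / p\<^sub>\<beta>)|\<close> over \<open>|\<beta>| = k\<close>. Since \<open>s / p\<^sub>\<beta> \<rightarrow> \<infinity>\<close> uniformly as \<open>|\<beta>| \<rightarrow> \<infinity>\<close> and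
  \<open>A\<close> vanishes at infinity, \<open>a\<^sub>k \<rightarrow> 0\<close>; this beats the number \<open>m\<^sup>n\<close> of words.

  Uniqueness: iterating the recursion \<open>n\<close> times gives
  \<open>G = (\<Sum>k<n. T\<^sub>k (A F)) + T\<^sub>n G\<close>, and \<open>T\<^sub>n G \<rightarrow> 0\<close> as soon as \<open>G\<close> is bounded near infinity.
\<close>

section \<open>The row-sum norm and the decay of \<open>Amat\<close> at infinity\<close>

lemma mat_norm_le_iff: "mat_norm M \<le> e \<longleftrightarrow> (\<forall>i. (\<Sum>j\<in>UNIV. \<bar>M $ i $ j\<bar>) \<le> e)"
  unfolding mat_norm_def by (subst Max_le_iff) auto

lemma row_sum_le_mat_norm: "(\<Sum>j\<in>UNIV. \<bar>M $ i $ j\<bar>) \<le> mat_norm M"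
  using mat_norm_le_iff[of M "mat_norm M"] by auto

lemma mat_norm_nonneg: "0 \<le> mat_norm M"
  by (rule order_trans[OF _ row_sum_le_mat_norm]) (auto intro: sum_nonneg)

lemma mat_norm_mult: "mat_norm (M ** N) \<le> mat_norm M * mat_norm N"
  unfolding mat_norm_le_iff
proof
  fix i
  have "(\<Sum>j\<in>UNIV. \<bar>(M ** N) $ i $ j\<bar>) \<le> (\<Sum>j\<in>UNIV. \<Sum>k\<in>UNIV. \<bar>M $ i $ k\<bar> * \<bar>N $ k $ j\<bar>)"
    unfolding matrix_matrix_mult_def
    by (intro sum_mono) (auto simp: abs_mult[symmetric])
  also have "\<dots> = (\<Sum>k\<in>UNIV. \<bar>M $ i $ k\<bar> * (\<Sum>j\<in>UNIV. \<bar>N $ k $ j\<bar>))"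
    by (subst sum.swap) (simp add: sum_distrib_left)
  also have "\<dots> \<le> (\<Sum>k\<in>UNIV. \<bar>M $ i $ k\<bar> * mat_norm N)"
    by (intro sum_mono mult_left_mono row_sum_le_mat_norm) auto
  also have "\<dots> \<le> mat_norm M * mat_norm N"
    by (simp flip: sum_distrib_right add: mult_right_mono row_sum_le_mat_norm mat_norm_nonneg)
  finally show "(\<Sum>j\<in>UNIV. \<bar>(M ** N) $ i $ j\<bar>) \<le> mat_norm M * mat_norm N" .
qed

lemma mat_norm_mult_le_right: "mat_norm M \<le> 1 \<Longrightarrow> mat_norm (M ** N) \<le> mat_norm N"
  using mat_norm_mult[of M N] mult_right_mono[of "mat_norm M" 1 "mat_norm N"] mat_norm_nonneg[of N]
  by simp

lemma mat_norm_mult_le_left: "mat_norm N \<le> 1 \<Longrightarrow> mat_norm (M ** N) \<le> mat_norm M"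
  using mat_norm_mult[of M N] mult_left_mono[of "mat_norm N" 1 "mat_norm M"] mat_norm_nonneg[of M]
  by simp

lemma mat_norm_mat_1: "mat_norm (mat 1 :: real^'m^'m::finite) \<le> 1"
  by (auto simp: mat_norm_le_iff mat_def if_distrib[of abs] cong: if_cong)

lemma mat_norm_unit_mat: "mat_norm (unit_mat (i::'m::finite)) \<le> 1"
proof -
  have "(\<Sum>j\<in>UNIV. \<bar>unit_mat i $ a $ j\<bar>) \<le> 1" for a
    by (cases "a = i") (auto simp: unit_mat_def if_distrib[of abs] cong: if_cong)
  then show ?thesis by (simp add: mat_norm_le_iff)
qed

lemma mat_norm_stochastic: "stochastic Q \<Longrightarrow> mat_norm Q \<le> 1"
  by (auto simp: mat_norm_le_iff stochastic_def)

lemma mat_norm_Amat_le_iff: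
  "mat_norm (Amat c l p w s) \<le> e \<longleftrightarrow> (\<forall>i. \<bar>gpar c l p i / (zpar c l w i - s)\<bar> \<le> e)"
  by (auto simp: mat_norm_le_iff Amat_def if_distrib[of abs] cong: if_cong)

lemma eventually_mat_norm_Amat_le:
  fixes c l p :: "'m::finite \<Rightarrow> real"
  assumes "0 < e"
  shows "\<forall>\<^sub>F s in at_top. mat_norm (Amat c l p w s) \<le> e"
  unfolding mat_norm_Amat_le_iff
proof (rule eventually_all_finite)
  fix i
  have "((\<lambda>s. 1 / (s - z)) \<longlongrightarrow> 0) at_top" for z :: real
    by real_asymp
  then have "((\<lambda>s. - gpar c l p i * (1 / (s - zpar c l w i))) \<longlongrightarrow> 0) at_top"
    by (rule tendsto_mult_right_zero)
  then have "((\<lambda>s. gpar c l p i / (zpar c l w i - s)) \<longlongrightarrow> 0) at_top"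
    by (simp add: minus_divide_right)
  then show "\<forall>\<^sub>F s in at_top. \<bar>gpar c l p i / (zpar c l w i - s)\<bar> \<le> e"
    using assms by (auto dest!: tendstoD elim: eventually_mono simp del: abs_divide)
qed

text \<open>Transfers bounds in \<open>mat_norm\<close> to the norm of the type, in which series of
  matrices converge.\<close>

lemma norm_le_mat_norm:
  fixes M :: "real^'m^'m::finite"
  shows "norm M \<le> CARD('m) * mat_norm M"
proof -
  have "norm M \<le> (\<Sum>i\<in>UNIV. \<Sum>j\<in>UNIV. \<bar>M $ i $ j\<bar>)"
    unfolding norm_vec_def[of M]
    by (rule order_trans[OF L2_set_le_sum]) (auto intro!: sum_mono norm_le_l1_cart)
  also have "\<dots> \<le> (\<Sum>i\<in>(UNIV::'m set). mat_norm M)"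
    by (intro sum_mono row_sum_le_mat_norm)
  finally show ?thesis by simp
qed

lemma bounded_linear_matrix_mult_left:
  fixes M :: "real^'m^'m::finite"
  shows "bounded_linear (\<lambda>X. M ** X)"
  by (intro linear_conv_bounded_linear[THEN iffD1] linearI)
     (simp_all add: matrix_matrix_mult_def vec_eq_iff sum_distrib_left sum.distrib algebra_simps)

section \<open>Words and their probabilities\<close>

lemma finite_words: "finite {\<alpha> :: 'm::finite list. length \<alpha> = n}"
  using finite_lists_length_eq[of "UNIV :: 'm set" n] by simp

lemma card_words: "card {\<alpha> :: 'm::finite list. length \<alpha> = n} = CARD('m) ^ n"
  using card_lists_length_eq[of "UNIV :: 'm set" n] by simp

lemma sum_words_Suc:
  "(\<Sum>\<alpha> | length \<alpha> = Suc n. f \<alpha>) =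
    (\<Sum>i\<in>UNIV. \<Sum>\<beta> | length \<beta> = n. f (i # \<beta> :: 'm::finite list))"
proof -
  have "{\<alpha> :: 'm list. length \<alpha> = Suc n} = (\<lambda>(i, \<beta>). i # \<beta>) ` (UNIV \<times> {\<beta>. length \<beta> = n})"
    by (auto simp: length_Suc_conv image_iff)
  moreover have "inj_on (\<lambda>(i, \<beta>). i # \<beta>) (UNIV \<times> {\<beta> :: 'm list. length \<beta> = n})"
    by (auto simp: inj_on_def)
  ultimately show ?thesis
    by (simp add: sum.reindex sum.cartesian_product) (simp add: case_prod_beta)
qed

lemma word_prob_Nil [simp]: "word_prob p [] = 1"
  and word_prob_Cons [simp]: "word_prob p (i # \<beta>) = p i * word_prob p \<beta>"
  by (simp_all add: word_prob_def)

text \<open>Prepending i to a word multiplies its probability by \<open>p i\<close>, so a pole at s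
  / p i would make s a pole. This lets the recursion be iterated off the poles.\<close>

lemma not_in_poles_divide:
  assumes "s \<notin> poles c l p w" "0 < p i"
  shows "s / p i \<notin> poles c l p w"
proof
  assume "s / p i \<in> poles c l p w"
  then obtain j \<alpha> where "s / p i = zpar c l w j * word_prob p \<alpha>"
    by (auto simp: poles_def)
  then have "s = zpar c l w j * word_prob p (i # \<alpha>)"
    using assms(2) by (simp add: field_simps)
  with assms(1) show False
    unfolding poles_def by blast
qed

text \<open>With r < 1 the largest \<open>p i\<close>, a word of length n has probability at most
  r^n, so s / \<open>word_prob p \<alpha>\<close> is at least s / r^n, uniformly over words of that
  length.\<close>

lemma eventually_words:
  fixes p :: "'m::finite \<Rightarrow> real"
  assumes "\<And>i. 0 < p i" "\<And>i. p i < 1" "0 < s" "eventually P at_top"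
  shows "\<forall>\<^sub>F n in sequentially. \<forall>\<alpha>. length \<alpha> = n \<longrightarrow> P (s / word_prob p \<alpha>)"
proof -
  define r where "r = Max (range p)"
  have r: "0 < r" "r < 1" "p i \<le> r" for i
    using assms(1,2) unfolding r_def by (auto simp: Max_gr_iff)
  have wp: "0 < word_prob p \<alpha> \<and> word_prob p \<alpha> \<le> r ^ length \<alpha>" for \<alpha>
    by (induction \<alpha>) (use assms(1) r in \<open>auto intro!: mult_mono simp: less_imp_le\<close>)
  obtain T where T: "\<And>t. T \<le> t \<Longrightarrow> P t"
    using assms(4) by (auto simp: eventually_at_top_linorder)
  have "filterlim (\<lambda>n. s / r ^ n) at_top sequentially"
    using r assms(3) by real_asymp
  then have "\<forall>\<^sub>F n in sequentially. T \<le> s / r ^ n"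
    by (simp add: filterlim_at_top)
  then show ?thesis
  proof eventually_elim
    case (elim n)
    show ?case
    proof (intro allI impI)
      fix \<alpha> :: "'m list" assume "length \<alpha> = n"
      then have "s / r ^ n \<le> s / word_prob p \<alpha>"
        using wp[of \<alpha>] assms(3) r by (auto intro!: divide_left_mono)
      with elim show "P (s / word_prob p \<alpha>)" by (intro T) simp
    qed
  qed
qed

section \<open>The operator \<open>Kop\<close>, word kernels and the Neumann series\<close>

lemma Kop_cong: "(\<And>i. G (s / p i) = H (s / p i)) \<Longrightarrow> Kop c l p w Q G s = Kop c l p w Q H s"
  by (simp add: Kop_def)

lemma Kop_add: "Kop c l p w Q (\<lambda>t. G t + H t) s = Kop c l p w Q G s + Kop c l p w Q H s"
  by (simp add: Kop_def matrix_add_ldistrib sum.distrib)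

lemma Kop_sums:
  fixes p :: "'m::finite \<Rightarrow> real"
  assumes "\<And>i. (\<lambda>n. T n (s / p i)) sums G (s / p i)"
  shows "(\<lambda>n. Kop c l p w Q (T n) s) sums Kop c l p w Q G s"
  unfolding Kop_def
  by (intro bounded_linear.sums[OF bounded_linear_matrix_mult_left] sums_sum assms)

lemma Kop_sum:
  fixes p :: "'m::finite \<Rightarrow> real" and n :: nat
  shows "Kop c l p w Q (\<lambda>t. \<Sum>k<n. T k t) s = (\<Sum>k<n. Kop c l p w Q (T k) s)"
  by (induction n)
     (simp_all add: Kop_add,
      simp add: Kop_def linear_0[OF bounded_linear.linear[OF bounded_linear_matrix_mult_left]])

text \<open>Recursion on the first letter moves the rest of the word to the argument s / p i,
  matching one application of \<open>Kop\<close>. The empty word gets the identity, so that length 0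
  joins the sums over words.\<close>

primrec word_kernel ::
  "('m::finite \<Rightarrow> real) \<Rightarrow> ('m \<Rightarrow> real) \<Rightarrow> ('m \<Rightarrow> real) \<Rightarrow> real \<Rightarrow> real^'m^'m
    \<Rightarrow> 'm list \<Rightarrow> real \<Rightarrow> real^'m^'m" where
  "word_kernel c l p w Q [] s = mat 1"
| "word_kernel c l p w Q (i # \<beta>) s =
     Amat c l p w s ** unit_mat i ** Q ** word_kernel c l p w Q \<beta> (s / p i)"

text \<open>Dividing s by the probability of a prefix of i # \<beta> that contains i is dividing s /
  p i by that of its other letters; hence s is generalised in the induction.\<close>

lemma word_kernel_eq_foldr:
  "word_kernel c l p w Q \<alpha> s =
    foldr (**)
      (map (\<lambda>k. Amat c l p w (s / word_prob p (take k \<alpha>)) ** unit_mat (\<alpha> ! k) ** Q)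
        [0..<length \<alpha>])
      (mat 1)"
proof (induction \<alpha> arbitrary: s)
  case (Cons i \<beta>)
  have "[0..<length (i # \<beta>)] = 0 # map Suc [0..<length \<beta>]"
    by (simp add: upt_conv_Cons map_Suc_upt del: upt_Suc)
  then show ?case
    by (simp add: Cons.IH o_def divide_divide_eq_left del: upt_Suc)
qed simp

lemma Kword_eq_word_kernel:
  assumes "\<alpha> \<noteq> []"
  shows "Kword c l p w Q \<alpha> s = word_kernel c l p w Q \<alpha> s"
proof -
  obtain i \<beta> where \<alpha>: "\<alpha> = i # \<beta>"
    using assms by (cases \<alpha>) auto
  \<comment> \<open>\<open>Kword\<close> counts letters from 1, so its factor k belongs to the
    letter \<open>\<beta> ! (k - 2)\<close> of the tail.\<close>
  have "[2..<length \<alpha> + 1] = map (\<lambda>k. k + 2) [0..<length \<beta>]"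
    using map_add_upt[of 2 "length \<beta>"] by (simp add: \<alpha> numeral_2_eq_2)
  then show ?thesis
    by (simp add: Kword_def \<alpha> word_kernel_eq_foldr[of _ _ _ _ _ \<beta>] o_def divide_divide_eq_left
        del: upt_Suc)
qed

definition word_sum ::
  "('m::finite \<Rightarrow> real) \<Rightarrow> ('m \<Rightarrow> real) \<Rightarrow> ('m \<Rightarrow> real) \<Rightarrow> real \<Rightarrow> real^'m^'m
    \<Rightarrow> (real \<Rightarrow> real^'m^'m) \<Rightarrow> nat \<Rightarrow> real \<Rightarrow> real^'m^'m" where
  "word_sum c l p w Q H n s =
     (\<Sum>\<alpha> | length \<alpha> = n. word_kernel c l p w Q \<alpha> s ** H (s / word_prob p \<alpha>))"

lemma word_sum_0 [simp]: "word_sum c l p w Q H 0 s = H s"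
  by (simp add: word_sum_def)

text \<open>\<open>Amat c l p w s ** unit_mat i ** Q\<close> factors out of all words that begin
  with i, leaving the sum over words of length n at s / p i.\<close>

lemma word_sum_Suc: "word_sum c l p w Q H (Suc n) s = Kop c l p w Q (word_sum c l p w Q H n) s"
  unfolding word_sum_def Kop_def sum_words_Suc
  by (simp add: linear_sum[OF bounded_linear.linear[OF bounded_linear_matrix_mult_left]]
      matrix_mul_assoc divide_divide_eq_left)

lemma Rop_eq_word_sum:
  "Rop c l p w Q H s = H s + (\<Sum>n. word_sum c l p w Q H (Suc n) s)"
proof -
  have "(\<Sum>\<alpha> | length \<alpha> = Suc n. Kword c l p w Q \<alpha> s ** H (s / word_prob p \<alpha>)) =
      word_sum c l p w Q H (Suc n) s" for n
    unfolding word_sum_def by (intro sum.cong)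
      (auto simp: Kword_eq_word_kernel simp flip: length_greater_0_conv)
  then show ?thesis by (simp add: Rop_def)
qed

text \<open>The summand H s outside the series of \<open>Rop\<close> is the term of the empty
  word.\<close>

lemma Rop_sums:
  assumes "summable (\<lambda>n. word_sum c l p w Q H n s)"
  shows "(\<lambda>n. word_sum c l p w Q H n s) sums Rop c l p w Q H s"
  using summable_sums[OF assms] suminf_split_head[OF assms]
  by (simp add: Rop_eq_word_sum)

text \<open>\<open>Kop\<close> passes through the series at the points s / p i and raises its index
  by one; the term left over is H s.\<close>

lemma Rop_recursion:
  assumes "summable (\<lambda>n. word_sum c l p w Q H n s)"
    and "\<And>i. summable (\<lambda>n. word_sum c l p w Q H n (s / p i))"
  shows "Rop c l p w Q H s = H s + Kop c l p w Q (Rop c l p w Q H) s"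
proof -
  have "(\<lambda>n. word_sum c l p w Q H (Suc n) s) sums Kop c l p w Q (Rop c l p w Q H) s"
    unfolding word_sum_Suc by (intro Kop_sums Rop_sums assms)
  then show ?thesis
    by (simp add: Rop_eq_word_sum sums_iff)
qed

lemma solution_expansion:
  assumes "solves_recursion c l p w Q F G" "\<And>i. 0 < p i" "0 < s" "s \<notin> poles c l p w"
  shows "G s = (\<Sum>k<n. word_sum c l p w Q (\<lambda>t. Amat c l p w t ** F t) k s) + word_sum c l p w Q G n s"
  using assms(3,4)
proof (induction n arbitrary: s)
  case (Suc n)
  let ?H = "\<lambda>t. Amat c l p w t ** F t"
  have "G s = ?H s + Kop c l p w Q G s"
    using assms(1) Suc.prems by (simp add: solves_recursion_def)
  also have "Kop c l p w Q G s =
      Kop c l p w Q (\<lambda>t. (\<Sum>k<n. word_sum c l p w Q ?H k t) + word_sum c l p w Q G n t) s"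
    using Suc.prems assms(2) by (intro Kop_cong Suc.IH not_in_poles_divide) auto
  also have "\<dots> = (\<Sum>k<n. word_sum c l p w Q ?H (Suc k) s) + word_sum c l p w Q G (Suc n) s"
    by (simp add: Kop_add Kop_sum word_sum_Suc)
  \<comment> \<open>The leading \<open>?H s\<close> is the term k = 0 of the longer sum.\<close>
  finally show ?case
    by (simp add: sum.lessThan_Suc_shift del: sum.lessThan_Suc)
qed simp

section \<open>Bounds on word kernels and convergence\<close>

definition Amax ::
  "('m::finite \<Rightarrow> real) \<Rightarrow> ('m \<Rightarrow> real) \<Rightarrow> ('m \<Rightarrow> real) \<Rightarrow> real \<Rightarrow> real \<Rightarrow> nat \<Rightarrow> real" where
  "Amax c l p w s k =
     Max ((\<lambda>\<beta>. mat_norm (Amat c l p w (s / word_prob p \<beta>))) ` {\<beta>. length \<beta> = k})"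

lemma Amax_le_iff:
  "Amax c l p w s k \<le> e \<longleftrightarrow>
    (\<forall>\<beta>. length \<beta> = k \<longrightarrow> mat_norm (Amat c l p w (s / word_prob p \<beta>)) \<le> e)"
proof -
  have "replicate k undefined \<in> {\<beta> :: 'a list. length \<beta> = k}" by simp
  then have "{\<beta> :: 'a list. length \<beta> = k} \<noteq> {}" by blast
  then show ?thesis
    unfolding Amax_def by (subst Max_le_iff) (auto simp: finite_words)
qed

lemma mat_norm_Amat_le_Amax:
  "mat_norm (Amat c l p w (s / word_prob p \<beta>)) \<le> Amax c l p w s (length \<beta>)"
  using Amax_le_iff[of c l p w s "length \<beta>" "Amax c l p w s (length \<beta>)"] by simp

lemma Amax_nonneg: "0 \<le> Amax c l p w s k"
  using order_trans[OF mat_norm_nonneg mat_norm_Amat_le_Amax[of c l p w s "replicate k undefined"]]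
  by simp

text \<open>A word \<beta> read from s / p i is the word i # \<beta> read from s, so the left
  maximum runs over some of the values on the right.\<close>

lemma Amax_divide_le: "Amax c l p w (s / p i) k \<le> Amax c l p w s (Suc k)"
  using mat_norm_Amat_le_Amax[of c l p w s "i # _"]
  by (auto simp: Amax_le_iff divide_divide_eq_left)

text \<open>\<open>unit_mat i\<close> and the stochastic Q have norm at most 1, so each letter
  contributes at most the norm of its \<open>Amat\<close>; dividing s by \<open>p i\<close> shifts
  the index of \<open>Amax\<close> by one.\<close>

lemma mat_norm_word_kernel_le:
  assumes "stochastic Q"
  shows "mat_norm (word_kernel c l p w Q \<alpha> s) \<le> (\<Prod>k<length \<alpha>. Amax c l p w s k)"
proof (induction \<alpha> arbitrary: s)
  case (Cons i \<beta>)
  have "mat_norm (Amat c l p w s ** unit_mat i ** Q) \<le> mat_norm (Amat c l p w s)"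
    by (rule order_trans[OF mat_norm_mult_le_left mat_norm_mult_le_left])
       (simp_all add: assms mat_norm_stochastic mat_norm_unit_mat)
  also have "\<dots> \<le> Amax c l p w s 0"
    using mat_norm_Amat_le_Amax[of c l p w s "[]"] by simp
  finally have A: "mat_norm (Amat c l p w s ** unit_mat i ** Q) \<le> Amax c l p w s 0" .
  have B: "mat_norm (word_kernel c l p w Q \<beta> (s / p i)) \<le> (\<Prod>k<length \<beta>. Amax c l p w s (Suc k))"
    by (rule order_trans[OF Cons.IH]) (intro prod_mono conjI Amax_nonneg Amax_divide_le)
  have "mat_norm (word_kernel c l p w Q (i # \<beta>) s) \<le>
      Amax c l p w s 0 * (\<Prod>k<length \<beta>. Amax c l p w s (Suc k))"
    unfolding word_kernel.simps
    by (rule order_trans[OF mat_norm_mult mult_mono[OF A B]]) (auto intro: Amax_nonneg mat_norm_nonneg)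
  then show ?case
    by (simp add: prod.lessThan_Suc_shift del: prod.lessThan_Suc)
qed (simp add: mat_norm_mat_1)

lemma eventually_Amax_le:
  assumes "\<And>i. 0 < p i" "\<And>i. p i < 1" "0 < s" "0 < e"
  shows "\<forall>\<^sub>F n in sequentially. Amax c l p w s n \<le> e"
  using eventually_words[OF assms(1-3) eventually_mat_norm_Amat_le[OF assms(4)], of c l p w]
  by (simp add: Amax_le_iff)

lemma summable_Amax_prod:
  fixes p :: "'m::finite \<Rightarrow> real"
  assumes "\<And>i. 0 < p i" "\<And>i. p i < 1" "0 < s"
  shows "summable (\<lambda>n. real CARD('m) ^ n * (\<Prod>k<n. Amax c l p w s k))"
proof -
  let ?b = "\<lambda>n. real CARD('m) ^ n * (\<Prod>k<n. Amax c l p w s k)"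
  \<comment> \<open>This threshold makes the ratio of consecutive terms,
    \<open>CARD('m) * Amax c l p w s n\<close>, at most 1 / 2.\<close>
  have "\<forall>\<^sub>F n in sequentially. Amax c l p w s n \<le> 1 / (2 * real CARD('m))"
    by (intro eventually_Amax_le assms) auto
  then obtain N where N: "\<And>n. N \<le> n \<Longrightarrow> Amax c l p w s n \<le> 1 / (2 * real CARD('m))"
    by (auto simp: eventually_sequentially)
  show ?thesis
  proof (rule summable_ratio_test[of "1 / 2" N])
    fix n assume "N \<le> n"
    then have "real CARD('m) * Amax c l p w s n \<le> 1 / 2"
      using N[of n] by (simp add: field_simps)
    moreover have nn: "0 \<le> ?b n" for n
      by (auto intro!: prod_nonneg mult_nonneg_nonneg Amax_nonneg)
    moreover have "?b (Suc n) = real CARD('m) * Amax c l p w s n * ?b n"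
      by (simp add: algebra_simps)
    ultimately have "?b (Suc n) \<le> 1 / 2 * ?b n"
      using mult_right_mono by metis
    with nn[of n] nn[of "Suc n"] show "norm (?b (Suc n)) \<le> 1 / 2 * norm (?b n)"
      unfolding real_norm_def by (simp only: abs_of_nonneg)
  qed simp
qed

text \<open>The bound on H is asked only at the arguments of long words: A F may blow up near poles,
  and a solution G is controlled only near infinity.\<close>

lemma summable_mat_norm_words:
  fixes p :: "'m::finite \<Rightarrow> real"
  assumes "\<And>i. 0 < p i" "\<And>i. p i < 1" "0 < s" "stochastic Q"
    and "\<forall>\<^sub>F n in sequentially. \<forall>\<alpha>. length \<alpha> = n \<longrightarrow> mat_norm (H (s / word_prob p \<alpha>)) \<le> B"
  shows "summable (\<lambda>n. \<Sum>\<alpha> | length \<alpha> = n.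
    mat_norm (word_kernel c l p w Q \<alpha> s ** H (s / word_prob p \<alpha>)))"
proof (rule summable_comparison_test_ev)
  let ?a = "\<lambda>n. \<Prod>k<n. Amax c l p w s k"
  show "summable (\<lambda>n. real CARD('m) ^ n * ?a n * B)"
    by (intro summable_mult2 summable_Amax_prod assms)
  show "\<forall>\<^sub>F n in sequentially. norm (\<Sum>\<alpha> | length \<alpha> = n.
      mat_norm (word_kernel c l p w Q \<alpha> s ** H (s / word_prob p \<alpha>))) \<le> real CARD('m) ^ n * ?a n * B"
    using assms(5)
  proof eventually_elim
    case (elim n)
    have "mat_norm (word_kernel c l p w Q \<alpha> s ** H (s / word_prob p \<alpha>)) \<le> ?a n * B"
      if "\<alpha> \<in> {\<alpha>. length \<alpha> = n}" for \<alpha>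
      using elim that mat_norm_word_kernel_le[OF assms(4), of c l p w \<alpha> s]
      by (intro order_trans[OF mat_norm_mult] mult_mono)
         (auto intro: mat_norm_nonneg prod_nonneg Amax_nonneg)
    then have "(\<Sum>\<alpha> | length \<alpha> = n. mat_norm (word_kernel c l p w Q \<alpha> s ** H (s / word_prob p \<alpha>)))
        \<le> (\<Sum>\<alpha> | length (\<alpha> :: 'm list) = n. ?a n * B)"
      by (rule sum_mono)
    also have "\<dots> = real CARD('m) ^ n * ?a n * B"
      by (simp add: card_words)
    finally show ?case
      by (simp add: sum_nonneg mat_norm_nonneg)
  qed
qed

lemma summable_word_sum:
  fixes p :: "'m::finite \<Rightarrow> real"
  assumes "summable (\<lambda>n. \<Sum>\<alpha> | length \<alpha> = n.
    mat_norm (word_kernel c l p w Q \<alpha> s ** H (s / word_prob p \<alpha>)))"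
  shows "summable (\<lambda>n. word_sum c l p w Q H n s)"
proof (rule summable_comparison_test')
  show "summable (\<lambda>n. real CARD('m) * (\<Sum>\<alpha> | length \<alpha> = n.
      mat_norm (word_kernel c l p w Q \<alpha> s ** H (s / word_prob p \<alpha>))))"
    by (intro summable_mult assms)
  show "norm (word_sum c l p w Q H n s) \<le> real CARD('m) * (\<Sum>\<alpha> | length \<alpha> = n.
      mat_norm (word_kernel c l p w Q \<alpha> s ** H (s / word_prob p \<alpha>)))" if "0 \<le> n" for n
    unfolding word_sum_def sum_distrib_left
    by (intro sum_norm_le norm_le_mat_norm)
qed

lemma Rop_abs_convergentI:
  assumes "summable (\<lambda>n. \<Sum>\<alpha> | length \<alpha> = n.
    mat_norm (word_kernel c l p w Q \<alpha> s ** H (s / word_prob p \<alpha>)))"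
  shows "Rop_abs_convergent c l p w Q H s"
proof -
  have "(\<Sum>\<alpha> | length \<alpha> = Suc n. mat_norm (Kword c l p w Q \<alpha> s ** H (s / word_prob p \<alpha>))) =
      (\<Sum>\<alpha> | length \<alpha> = Suc n. mat_norm (word_kernel c l p w Q \<alpha> s ** H (s / word_prob p \<alpha>)))" for n
    by (intro sum.cong)
      (auto simp: Kword_eq_word_kernel simp flip: length_greater_0_conv)
  then show ?thesis
    unfolding Rop_abs_convergent_def using summable_ignore_initial_segment[OF assms, of 1] by simp
qed

theorem proposition3p2:
  fixes c l p :: "'m::finite \<Rightarrow> real" and w :: real and Q :: "real^'m^'m"
    and F :: "real \<Rightarrow> real^'m^'m"
  assumes "\<And>i. 0 < c i" and "\<And>i. 0 < l i" and "\<And>i. 0 < p i" and "\<And>i. p i < 1"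
    and "0 < w" and "stochastic Q"
    and "\<exists>B. \<forall>s>0. mat_norm (F s) \<le> B"
  shows "(\<forall>s>0. s \<notin> poles c l p w \<longrightarrow>
            Rop_abs_convergent c l p w Q F s \<and>
            Rop_abs_convergent c l p w Q (\<lambda>t. Amat c l p w t ** F t) s) \<and>
         solves_recursion c l p w Q F (Rop c l p w Q (\<lambda>t. Amat c l p w t ** F t)) \<and>
         (\<forall>G. solves_recursion c l p w Q F G \<and> (\<lambda>s. mat_norm (G s)) \<in> O(\<lambda>s. 1 / s) \<longrightarrow>
            (\<forall>s>0. s \<notin> poles c l p w \<longrightarrow>
               G s = Rop c l p w Q (\<lambda>t. Amat c l p w t ** F t) s))"
proof -
  let ?H = "\<lambda>t. Amat c l p w t ** F t"
  obtain B where B: "\<And>s. 0 < s \<Longrightarrow> mat_norm (F s) \<le> B"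
    using assms(7) by blast
  have evF: "\<forall>\<^sub>F t in at_top. mat_norm (F t) \<le> B"
    using eventually_gt_at_top[of "0::real"] by eventually_elim (rule B)
  \<comment> \<open>Near infinity \<open>Amat\<close> has norm at most 1, so the bound B on F also
    serves for A F.\<close>
  have evH: "\<forall>\<^sub>F t in at_top. mat_norm (?H t) \<le> B"
    using evF eventually_mat_norm_Amat_le[of 1 c l p w, OF zero_less_one]
    by eventually_elim (rule order_trans[OF mat_norm_mult_le_right])
  have summ: "summable (\<lambda>n. \<Sum>\<alpha> | length \<alpha> = n.
      mat_norm (word_kernel c l p w Q \<alpha> s ** X (s / word_prob p \<alpha>)))"
    if "0 < s" "\<forall>\<^sub>F t in at_top. mat_norm (X t) \<le> b" for s b and X :: "real \<Rightarrow> real^'m^'m"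
    using assms that by (intro summable_mat_norm_words eventually_words) auto
  \<comment> \<open>A vanishing denominator in \<open>Amat\<close> gives the entry 0, since x / 0 =
    0, so the estimates make sense at each s > 0.\<close>
  have sumH: "summable (\<lambda>n. word_sum c l p w Q ?H n s)" if "0 < s" for s
    using that evH by (auto intro: summable_word_sum summ)
  have unique: "G s = Rop c l p w Q ?H s"
    if G: "solves_recursion c l p w Q F G" "(\<lambda>s. mat_norm (G s)) \<in> O(\<lambda>s. 1 / s)"
      and s: "0 < s" "s \<notin> poles c l p w" for G s
  proof -
    obtain C where C: "0 < C" "\<forall>\<^sub>F t in at_top. norm (mat_norm (G t)) \<le> C * norm (1 / t)"
      using landau_o.bigE[OF G(2)] by blast
    \<comment> \<open>For t \<ge> 1 the bound C / t is at most C, which gives the boundedness near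
      infinity that \<open>summ\<close> asks for.\<close>
    have "\<forall>\<^sub>F t in at_top. mat_norm (G t) \<le> C"
      using C(2) eventually_ge_at_top[of "1::real"]
    proof eventually_elim
      case (elim t)
      have "C * norm (1 / t) \<le> C * 1"
        using C(1) elim by (intro mult_left_mono) auto
      with elim show ?case by simp
    qed
    \<comment> \<open>The remainders of the expansion of G are themselves the terms of a convergent
      series, so they tend to 0.\<close>
    then have "(\<lambda>n. word_sum c l p w Q G n s) \<longlonglongrightarrow> 0"
      using s by (intro summable_LIMSEQ_zero summable_word_sum summ)
    moreover have "(\<lambda>n. \<Sum>k<n. word_sum c l p w Q ?H k s) \<longlonglongrightarrow> Rop c l p w Q ?H s"
      using Rop_sums[OF sumH[OF s(1)]] by (simp add: sums_def)
    ultimately have "(\<lambda>n. (\<Sum>k<n. word_sum c l p w Q ?H k s) + word_sum c l p w Q G n s)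
        \<longlonglongrightarrow> Rop c l p w Q ?H s + 0"
      by (intro tendsto_add)
    then have "(\<lambda>n. G s) \<longlonglongrightarrow> Rop c l p w Q ?H s"
      using solution_expansion[OF G(1) assms(3) s] by simp
    then show ?thesis
      by (simp add: LIMSEQ_const_iff)
  qed
  have "Rop_abs_convergent c l p w Q F s \<and> Rop_abs_convergent c l p w Q ?H s" if "0 < s" for s
    using that evF evH by (auto intro: Rop_abs_convergentI summ)
  moreover have "solves_recursion c l p w Q F (Rop c l p w Q ?H)"
    unfolding solves_recursion_def using assms(3) by (auto intro!: Rop_recursion sumH)
  ultimately show ?thesis
    using unique by blast
qed

end
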